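(* Given an additive sequential scrip bargaining $F=\langle K,v_1,v_2,\tau\rangle$ with $k=|K|$ items and integer valuations, there is an equivalent binary bidding game with $|S|\le (k+1)\cdot M$ states, where $M=(v_1(K)+1)\times(v_2(K)+1)$. Further, such a bidding game can be constructed efficiently.
   Context: A (two-player) sequential scrip bargaining (SSB) is $F=\langle K,v_1,v_2,\tau\rangle$, where $K$ is a finite set of $k$ items, $v_i:2^K\to\mathbb R$ is the value function of agent $i\in\{1,2\}$, and $\tau$ is a permutation of $K$ giving the order in which items are offered. Agents hold budgets $B_1,B_2$ with $B_1+B_2=1$. In each turn they simultaneously bid at most their current budgets for the current item; the higher bidder wins (agent 1 wins ties), pays her bid to the other agent, and decides which of the two agents gets the item. Budgets have no value outside the game: at final allocation $(K^1,K^2)$ agent $i$'s utility is $v_i(K^i)$. $F$ is additive if $v_i(A)=\sum_{j\in A}v_i(j)$ for all $A\subseteq K$, $i=1,2$; integer valuations means that all values are integers. A binary game structure is $G=\langle S,s_0,T,g,u_1,u_2\rangle$ with finite state set $S$, initial state $s_0$, terminals $T\subseteq S$, a move function $g$ with $1\le|g(s)|\le2$ for $s\in S\setminus T$ (acyclic; a directed acyclic graph is allowed), and $u_i:T\to\mathbb R$. In the corresponding bidding game with resolution $\varepsilon$ (budgets and bids are multiples of $\varepsilon$), at each nonterminal state $s$ players simultaneously bid at most their budgets and select a next state in $g(s)$; the higher bidder (player 1 in ties) pays her bid to the other player and her selected state is played; utilities are $u_i$ at the terminal reached. Two such games are equivalent if, for any resolution $\varepsilon$, there is a one-to-one mapping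 between strategy profiles in the original and the induced game that preserves utilities.
   Formalization: Values are assumed nonnegative, and if some item is worthless to both agents a state may list the same next state twice as two moves (the claim fails otherwise); decisions are submitted with the bids, and "efficiently" means in time polynomial in (k+1)M. *)

theory Defs
  imports Complex_Main "HOL-Library.FuncSet"
begin

section \<open>Repeated bidding with a fixed resolution\<close>

datatype agent = Agent1 | Agent2

text \<open>
  Bids and budgets are families indexed by \<^typ>\<open>agent\<close>.  A turn records the two bids and the
  decision carried out, i.e. the one of the winner of the turn.  A history lists the turns played
  so far, oldest first.
\<close>

type_synonym 'c history = "((agent \<Rightarrow> real) \<times> 'c) list"

definition winner :: "(agent \<Rightarrow> real) \<Rightarrow> agent" where
  "winner b = (if b Agent1 \<ge> b Agent2 then Agent1 else Agent2)"

definition pay :: "(agent \<Rightarrow> real) \<Rightarrow> (agent \<Rightarrow> real) \<Rightarrow> agent \<Rightarrow> real" where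
  "pay B b = (\<lambda>i. if i = winner b then B i - b i else B i + b (winner b))"

definition budget_after :: "(agent \<Rightarrow> real) \<Rightarrow> 'c history \<Rightarrow> agent \<Rightarrow> real" where
  "budget_after B h = foldl (\<lambda>B' (b, c). pay B' b) B h"

definition initial_budgets :: "real \<Rightarrow> (agent \<Rightarrow> real) set" where
  "initial_budgets \<epsilon> =
     {B. B Agent1 + B Agent2 = 1 \<and> (\<forall>i. \<exists>n::nat. B i = real n * \<epsilon>)}"

definition legal_bids :: "real \<Rightarrow> real \<Rightarrow> real set" where
  "legal_bids \<epsilon> x = {b. b \<le> x \<and> (\<exists>n::nat. b = real n * \<epsilon>)}"

text \<open>
  The following notions are shared by both kinds of games.  The parameter \<open>choices\<close> yields the
  decisions available after a history; there are none exactly when the game is over.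
\<close>

inductive_set legal_histories ::
    "('c history \<Rightarrow> 'c set) \<Rightarrow> real \<Rightarrow> (agent \<Rightarrow> real) \<Rightarrow> 'c history set"
  for choices \<epsilon> B where
  start: "[] \<in> legal_histories choices \<epsilon> B"
| turn: "\<lbrakk>h \<in> legal_histories choices \<epsilon> B; \<And>i. b i \<in> legal_bids \<epsilon> (budget_after B h i);
     c \<in> choices h\<rbrakk> \<Longrightarrow> h @ [(b, c)] \<in> legal_histories choices \<epsilon> B"

text \<open>
  A strategy fixes, after every legal unfinished history, a bid and the decision to be carried out
  if this bid wins.  The decision is submitted together with the bid, so it cannot react to the
  opponent's bid of the same turn.  Strategies are extensional functions, so that equality of
  strategies is equality on the histories where a move is due.
\<close>

definition strategies ::
    "('c history \<Rightarrow> 'c set) \<Rightarrow> real \<Rightarrow> (agent \<Rightarrow> real) \<Rightarrow> agent \<Rightarrow> ('c history \<Rightarrow> real \<times> 'c) set"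
  where "strategies choices \<epsilon> B i =
     (\<Pi>\<^sub>E h\<in>{h \<in> legal_histories choices \<epsilon> B. choices h \<noteq> {}}.
        legal_bids \<epsilon> (budget_after B h i) \<times> choices h)"

definition profiles ::
    "('c history \<Rightarrow> 'c set) \<Rightarrow> real \<Rightarrow> (agent \<Rightarrow> real) \<Rightarrow> (agent \<Rightarrow> 'c history \<Rightarrow> real \<times> 'c) set"
  where "profiles choices \<epsilon> B = {\<sigma>. \<forall>i. \<sigma> i \<in> strategies choices \<epsilon> B i}"

fun play ::
    "('c history \<Rightarrow> 'c set) \<Rightarrow> (agent \<Rightarrow> 'c history \<Rightarrow> real \<times> 'c) \<Rightarrow> nat \<Rightarrow> 'c history" where
  "play choices \<sigma> 0 = []"
| "play choices \<sigma> (Suc n) =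
     (let h = play choices \<sigma> n; b = (\<lambda>i. fst (\<sigma> i h)) in
        if choices h = {} then h else h @ [(b, snd (\<sigma> (winner b) h))])"

definition final_history ::
    "('c history \<Rightarrow> 'c set) \<Rightarrow> (agent \<Rightarrow> 'c history \<Rightarrow> real \<times> 'c) \<Rightarrow> 'c history" where
  "final_history choices \<sigma> = play choices \<sigma> (LEAST n. choices (play choices \<sigma> n) = {})"


section \<open>Sequential scrip bargaining\<close>

record 'a ssb =
  items :: "'a set"
  val :: "agent \<Rightarrow> 'a set \<Rightarrow> real"
  sale_order :: "'a list"

definition ssb :: "'a ssb \<Rightarrow> bool" where
  "ssb F \<longleftrightarrow> finite (items F) \<and> distinct (sale_order F) \<and> set (sale_order F) = items F"

definition additive_valued :: "'a ssb \<Rightarrow> bool" where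
  "additive_valued F \<longleftrightarrow> (\<forall>i. \<forall>A\<subseteq>items F. val F i A = (\<Sum>j\<in>A. val F i {j}))"

definition integer_valued :: "'a ssb \<Rightarrow> bool" where
  "integer_valued F \<longleftrightarrow> (\<forall>i. \<forall>A\<subseteq>items F. val F i A \<in> \<int>)"

definition nonnegative_valued :: "'a ssb \<Rightarrow> bool" where
  "nonnegative_valued F \<longleftrightarrow> (\<forall>i. \<forall>A\<subseteq>items F. 0 \<le> val F i A)"

text \<open>The decision of a turn is the agent who receives the item on offer.\<close>

definition ssb_choices :: "'a ssb \<Rightarrow> agent history \<Rightarrow> agent set" where
  "ssb_choices F h = (if length h < card (items F) then UNIV else {})"

definition allocation :: "'a ssb \<Rightarrow> agent history \<Rightarrow> agent \<Rightarrow> 'a set" where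
  "allocation F h i = {sale_order F ! t | t. t < length h \<and> snd (h ! t) = i}"

definition ssb_utility :: "'a ssb \<Rightarrow> (agent \<Rightarrow> agent history \<Rightarrow> real \<times> agent) \<Rightarrow> agent \<Rightarrow> real" where
  "ssb_utility F \<sigma> i = val F i (allocation F (final_history (ssb_choices F) \<sigma>) i)"


section \<open>Binary bidding games\<close>

text \<open>
  The moves at a state are given as a list of next states, and a move is selected by its position
  in this list.  In a \<open>simple\<close> structure no next state is listed twice, so selecting a move
  is selecting an element of a set of one or two next states.  Structures that are not simple are
  needed only for bargaining over an item that is worthless to both agents: the winner still
  decides who gets it, but within the bound on the number of states there may be room for only one
  next state.
\<close>

record 's bidding_game =
  states :: "'s set"
  initial :: 's
  terminals :: "'s set"
  moves :: "'s \<Rightarrow> 's list"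
  payoff :: "agent \<Rightarrow> 's \<Rightarrow> real"

definition binary_game :: "'s bidding_game \<Rightarrow> bool" where
  "binary_game G \<longleftrightarrow>
     finite (states G) \<and> initial G \<in> states G \<and> terminals G \<subseteq> states G \<and>
     (\<forall>s\<in>states G - terminals G.
        1 \<le> length (moves G s) \<and> length (moves G s) \<le> 2 \<and> set (moves G s) \<subseteq> states G) \<and>
     acyclic {(s, s'). s \<in> states G - terminals G \<and> s' \<in> set (moves G s)}"

definition simple :: "'s bidding_game \<Rightarrow> bool" where
  "simple G \<longleftrightarrow> (\<forall>s\<in>states G - terminals G. distinct (moves G s))"

definition state_after :: "'s bidding_game \<Rightarrow> nat history \<Rightarrow> 's" where
  "state_after G h = foldl (\<lambda>s (b, c). moves G s ! c) (initial G) h"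

definition game_choices :: "'s bidding_game \<Rightarrow> nat history \<Rightarrow> nat set" where
  "game_choices G h =
     (if state_after G h \<in> terminals G then {} else {..<length (moves G (state_after G h))})"

definition game_utility :: "'s bidding_game \<Rightarrow> (agent \<Rightarrow> nat history \<Rightarrow> real \<times> nat) \<Rightarrow> agent \<Rightarrow> real" where
  "game_utility G \<sigma> i = payoff G i (state_after G (final_history (game_choices G) \<sigma>))"

definition equivalent :: "'a ssb \<Rightarrow> 's bidding_game \<Rightarrow> bool" where
  "equivalent F G \<longleftrightarrow>
     (\<forall>\<epsilon>>0. \<forall>B\<in>initial_budgets \<epsilon>.
        \<exists>\<phi>. bij_betw \<phi> (profiles (ssb_choices F) \<epsilon> B) (profiles (game_choices G) \<epsilon> B) \<and>
            (\<forall>\<sigma>\<in>profiles (ssb_choices F) \<epsilon> B. \<forall>i. game_utility G (\<phi> \<sigma>) i = ssb_utility F \<sigma> i))"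


section \<open>Efficient construction\<close>

text \<open>
  Programs over registers holding natural numbers, with a random access input and an output that
  can only be appended to.  Every elementary operation and every test costs one step.  There is no
  multiplication, so each step increases the maximal bit length of the registers by at most one
  beyond that of the input numbers; hence a Turing machine needs only polynomial overhead to
  simulate a program.
\<close>

datatype prog =
    Const nat nat
  | Add nat nat nat
  | Sub nat nat nat
  | Input nat nat
  | Output nat
  | Seq prog prog
  | IfNZ nat prog prog
  | WhileNZ nat prog

text \<open>
  \<open>exec inp p (r, out) n (r', out')\<close>: on input \<open>inp\<close>, started with registers \<open>r\<close>
  and output \<open>out\<close>, the program \<open>p\<close> stops after \<open>n\<close> steps with registers \<open>r'\<close> and output \<open>out'\<close>.
  Subtraction is truncated at zero; input positions past the end hold zero.
\<close>

inductive exec ::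
    "nat list \<Rightarrow> prog \<Rightarrow> (nat \<Rightarrow> nat) \<times> nat list \<Rightarrow> nat \<Rightarrow> (nat \<Rightarrow> nat) \<times> nat list \<Rightarrow> bool"
  for inp where
  Const: "exec inp (Const x n) (r, out) 1 (r(x := n), out)"
| Add: "exec inp (Add x y z) (r, out) 1 (r(x := r y + r z), out)"
| Sub: "exec inp (Sub x y z) (r, out) 1 (r(x := r y - r z), out)"
| Input: "exec inp (Input x y) (r, out) 1
     (r(x := if r y < length inp then inp ! r y else 0), out)"
| Output: "exec inp (Output x) (r, out) 1 (r, out @ [r x])"
| Seq: "\<lbrakk>exec inp p c m c'; exec inp q c' n c''\<rbrakk> \<Longrightarrow> exec inp (Seq p q) c (m + n) c''"
| IfTrue: "\<lbrakk>r x \<noteq> 0; exec inp p (r, out) n c\<rbrakk> \<Longrightarrow> exec inp (IfNZ x p q) (r, out) (Suc n) c"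
| IfFalse: "\<lbrakk>r x = 0; exec inp q (r, out) n c\<rbrakk> \<Longrightarrow> exec inp (IfNZ x p q) (r, out) (Suc n) c"
| WhileFalse: "r x = 0 \<Longrightarrow> exec inp (WhileNZ x p) (r, out) 1 (r, out)"
| WhileTrue: "\<lbrakk>r x \<noteq> 0; exec inp p (r, out) m c; exec inp (WhileNZ x p) c n c'\<rbrakk>
     \<Longrightarrow> exec inp (WhileNZ x p) (r, out) (Suc (m + n)) c'"

definition computes_within :: "prog \<Rightarrow> nat list \<Rightarrow> nat list \<Rightarrow> real \<Rightarrow> bool" where
  "computes_within p inp out t \<longleftrightarrow>
     (\<exists>n r. exec inp p (\<lambda>_. 0, []) n (r, out) \<and> real n \<le> t)"

text \<open>
  An additive bargaining is input as the number of items followed by the values of every item for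
  the two agents, item by item in the order of sale.  No information is lost when the values are
  nonnegative integers.
\<close>

definition ssb_code :: "'a ssb \<Rightarrow> nat list" where
  "ssb_code F = card (items F) #
     concat (map (\<lambda>j. [nat \<lfloor>val F Agent1 {j}\<rfloor>, nat \<lfloor>val F Agent2 {j}\<rfloor>]) (sale_order F))"

text \<open>
  A structure is output as the number \<open>N\<close> of its states, its initial state, and one entry for each
  of its states \<open>0, \<dots>, N - 1\<close>.  The entry of a nonterminal state is the number of its moves
  followed by the next states; that of a terminal state is a zero followed by the two payoffs.
\<close>

definition state_code :: "nat bidding_game \<Rightarrow> nat \<Rightarrow> nat list" where
  "state_code G s =
     (if s \<in> terminals G then [0, nat \<lfloor>payoff G Agent1 s\<rfloor>, nat \<lfloor>payoff G Agent2 s\<rfloor>]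
      else length (moves G s) # moves G s)"

definition is_code_of :: "nat list \<Rightarrow> nat bidding_game \<Rightarrow> bool" where
  "is_code_of xs G \<longleftrightarrow>
     (\<exists>N. states G = {..<N} \<and> (\<forall>s\<in>terminals G. \<forall>i. payoff G i s \<in> \<nat>) \<and>
          xs = N # initial G # concat (map (state_code G) [0..<N]))"

end

theory Submission
  imports Defs
begin

text \<open>Merging histories with equal totals into one state loses nothing, because strategies see
  histories rather than states and a history of the game records positions in move lists. Histories
  ending in the same state therefore stay distinct, even after an item worthless to both agents,
  where both positions lead to the same next state. Bids, payments and winners are unaffected by
  relabelling, so it remains to compare the decisions available after corresponding histories and
  the utilities at the end. Each layer keeps all \<open>M\<close> codes of pairs, reachable or not.
  The states are then an initial segment of the naturals, and the program emits them in order by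
  counting, with no search and no division. Loops that count up to a value, instead of its bit
  length, are affordable because the time is measured against the number of states, which the output
  lists anyway.\<close>

text \<open>
  The utilities depend only on the total values that the agents have collected, so the game only has
  to remember how many items were sold and these two totals.  Decisions in both games are in bijection
  after every history, and relabelling them carries strategy profiles of one game to the other.
\<close>

section \<open>Relabelling decisions\<close>

definition relabel :: "('c \<Rightarrow> 'd) \<Rightarrow> 'c history \<Rightarrow> 'd history" where
  "relabel f = map (map_prod id f)"

lemma relabel_simps [simp]:
  "relabel f [] = []"
  "relabel f (h @ h') = relabel f h @ relabel f h'"
  "relabel f [(b, c)] = [(b, f c)]"
  "length (relabel f h) = length h"
  by (simp_all add: relabel_def)

lemma budget_after_relabel [simp]: "budget_after B (relabel f h) = budget_after B h"
  by (induction h rule: rev_induct) (auto simp: budget_after_def)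

lemma relabel_inverse:
  assumes "\<And>c. g (f c) = c"
  shows "relabel g (relabel f h) = h"
  using assms by (auto simp: relabel_def intro!: map_idI)

section \<open>Profiles and the histories they produce\<close>

lemma profile_move:
  assumes "\<sigma> \<in> profiles choices \<epsilon> B" "h \<in> legal_histories choices \<epsilon> B" "choices h \<noteq> {}"
  shows "\<sigma> i h \<in> legal_bids \<epsilon> (budget_after B h i) \<times> choices h"
proof -
  have "\<sigma> i \<in> strategies choices \<epsilon> B i" using assms(1) by (simp add: profiles_def)
  then show ?thesis unfolding strategies_def by (rule PiE_mem) (use assms in simp)
qed

lemma profile_undefined:
  assumes "\<sigma> \<in> profiles choices \<epsilon> B" "\<not> (h \<in> legal_histories choices \<epsilon> B \<and> choices h \<noteq> {})"
  shows "\<sigma> i h = undefined"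
proof -
  have "\<sigma> i \<in> strategies choices \<epsilon> B i" using assms(1) by (simp add: profiles_def)
  then show ?thesis unfolding strategies_def by (rule PiE_arb) (use assms in simp)
qed

text \<open>The hypothesis comparing the choices of two games covers legal histories only, so play
  must be known to stay among them.\<close>

lemma play_legal:
  assumes "\<sigma> \<in> profiles choices \<epsilon> B"
  shows "play choices \<sigma> n \<in> legal_histories choices \<epsilon> B"
proof (induction n)
  case 0
  show ?case by (simp add: legal_histories.start)
next
  case (Suc n)
  define h where "h = play choices \<sigma> n"
  show ?case
  proof (cases "choices h = {}")
    case True
    then show ?thesis using Suc by (simp add: h_def)
  next
    case False
    then have "\<sigma> i h \<in> legal_bids \<epsilon> (budget_after B h i) \<times> choices h" for i
      using Suc by (intro profile_move[OF assms]) (simp_all add: h_def)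
    then have "fst (\<sigma> i h) \<in> legal_bids \<epsilon> (budget_after B h i)" "snd (\<sigma> i h) \<in> choices h" for i
      by (auto simp: mem_Times_iff)
    then show ?thesis using False Suc
      by (auto simp: Let_def h_def[symmetric] intro!: legal_histories.turn)
  qed
qed

section \<open>Transport of strategy profiles along an injective relabelling\<close>

context
  fixes f :: "'c \<Rightarrow> 'd" and ch1 :: "'c history \<Rightarrow> 'c set" and ch2 :: "'d history \<Rightarrow> 'd set"
    and \<epsilon> :: real and B :: "agent \<Rightarrow> real"
  assumes inj: "inj f"
    and choices_relabel: "\<And>h. h \<in> legal_histories ch1 \<epsilon> B \<Longrightarrow> ch2 (relabel f h) = f ` ch1 h"
begin

text \<open>Legality of a turn depends on the budgets, which relabelling leaves alone, and on the
  available decisions, which correspond by \<open>choices_relabel\<close>.\<close>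

lemma legal_histories_relabel:
  "legal_histories ch2 \<epsilon> B = relabel f ` legal_histories ch1 \<epsilon> B"
proof (intro equalityI subsetI)
  fix h' assume "h' \<in> legal_histories ch2 \<epsilon> B"
  then show "h' \<in> relabel f ` legal_histories ch1 \<epsilon> B"
  proof induction
    case start
    show ?case by (auto intro!: image_eqI[of _ _ "[]"] legal_histories.start)
  next
    case (turn h' b d)
    then obtain h where h: "h \<in> legal_histories ch1 \<epsilon> B" "h' = relabel f h" by auto
    with turn choices_relabel obtain c where c: "c \<in> ch1 h" "d = f c" by auto
    have "h @ [(b, c)] \<in> legal_histories ch1 \<epsilon> B"
      using h c turn by (auto intro!: legal_histories.turn)
    then show ?case using h c by (auto intro!: image_eqI[of _ _ "h @ [(b, c)]"])
  qed
next
  fix h' assume "h' \<in> relabel f ` legal_histories ch1 \<epsilon> B"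
  then obtain h where "h \<in> legal_histories ch1 \<epsilon> B" "h' = relabel f h" by auto
  then show "h' \<in> legal_histories ch2 \<epsilon> B"
  proof (induction arbitrary: h')
    case start
    then show ?case by (simp add: legal_histories.start)
  next
    case (turn h b c)
    then show ?case by (auto intro!: legal_histories.turn simp: choices_relabel)
  qed
qed

text \<open>The restriction keeps the result extensional. On the histories that remain
  \<open>inv f\<close> is a genuine inverse, since all of them are relabelled histories of the first
  game.\<close>

definition relabel_profile ::
    "(agent \<Rightarrow> 'c history \<Rightarrow> real \<times> 'c) \<Rightarrow> agent \<Rightarrow> 'd history \<Rightarrow> real \<times> 'd" where
  "relabel_profile \<sigma> i = restrict (\<lambda>h. map_prod id f (\<sigma> i (relabel (inv f) h)))
     {h \<in> legal_histories ch2 \<epsilon> B. ch2 h \<noteq> {}}"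

definition unlabel_profile ::
    "(agent \<Rightarrow> 'd history \<Rightarrow> real \<times> 'd) \<Rightarrow> agent \<Rightarrow> 'c history \<Rightarrow> real \<times> 'c" where
  "unlabel_profile \<tau> i = restrict (\<lambda>h. map_prod id (inv f) (\<tau> i (relabel f h)))
     {h \<in> legal_histories ch1 \<epsilon> B. ch1 h \<noteq> {}}"

lemma inv_relabel: "relabel (inv f) (relabel f h) = h"
  by (simp add: relabel_inverse inj)

lemma relabel_profile_relabel:
  assumes "h \<in> legal_histories ch1 \<epsilon> B" "ch1 h \<noteq> {}"
  shows "relabel_profile \<sigma> i (relabel f h) = map_prod id f (\<sigma> i h)"
  using assms by (simp add: relabel_profile_def inv_relabel legal_histories_relabel choices_relabel)

lemma relabel_profile_in:
  assumes "\<sigma> \<in> profiles ch1 \<epsilon> B"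
  shows "relabel_profile \<sigma> \<in> profiles ch2 \<epsilon> B"
proof -
  have "relabel_profile \<sigma> i h' \<in> legal_bids \<epsilon> (budget_after B h' i) \<times> ch2 h'"
    if h': "h' \<in> legal_histories ch2 \<epsilon> B" "ch2 h' \<noteq> {}" for i h'
  proof -
    obtain h where h: "h \<in> legal_histories ch1 \<epsilon> B" "h' = relabel f h"
      using h' legal_histories_relabel by auto
    then have ne: "ch1 h \<noteq> {}" using h' choices_relabel by auto
    then have "\<sigma> i h \<in> legal_bids \<epsilon> (budget_after B h i) \<times> ch1 h"
      using assms h by (intro profile_move)
    then show ?thesis using h ne by (auto simp: relabel_profile_relabel choices_relabel)
  qed
  then show ?thesis
    unfolding profiles_def strategies_def mem_Collect_eq
    by (intro allI PiE_I) (auto simp: relabel_profile_def)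
qed

lemma unlabel_profile_in:
  assumes "\<tau> \<in> profiles ch2 \<epsilon> B"
  shows "unlabel_profile \<tau> \<in> profiles ch1 \<epsilon> B"
proof -
  have "unlabel_profile \<tau> i h \<in> legal_bids \<epsilon> (budget_after B h i) \<times> ch1 h"
    if h: "h \<in> legal_histories ch1 \<epsilon> B" "ch1 h \<noteq> {}" for i h
  proof -
    have "relabel f h \<in> legal_histories ch2 \<epsilon> B" "ch2 (relabel f h) \<noteq> {}"
      using h by (auto simp: legal_histories_relabel choices_relabel)
    then have "\<tau> i (relabel f h) \<in> legal_bids \<epsilon> (budget_after B h i) \<times> f ` ch1 h"
      using profile_move[OF assms, of "relabel f h" i] choices_relabel[OF h(1)] by simp
    then show ?thesis using h by (auto simp: unlabel_profile_def inj)
  qed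
  then show ?thesis
    unfolding profiles_def strategies_def mem_Collect_eq
    by (intro allI PiE_I) (auto simp: unlabel_profile_def)
qed

lemma unlabel_relabel_profile:
  assumes "\<sigma> \<in> profiles ch1 \<epsilon> B"
  shows "unlabel_profile (relabel_profile \<sigma>) = \<sigma>"
proof (intro ext)
  fix i h
  show "unlabel_profile (relabel_profile \<sigma>) i h = \<sigma> i h"
  proof (cases "h \<in> legal_histories ch1 \<epsilon> B \<and> ch1 h \<noteq> {}")
    case True
    then show ?thesis
      by (simp add: unlabel_profile_def relabel_profile_relabel inj map_prod_def split_beta)
  next
    case False
    then have "\<sigma> i h = undefined" by (rule profile_undefined[OF assms])
    then show ?thesis using False by (auto simp: unlabel_profile_def)
  qed
qed

lemma relabel_unlabel_profile:
  assumes "\<tau> \<in> profiles ch2 \<epsilon> B"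
  shows "relabel_profile (unlabel_profile \<tau>) = \<tau>"
proof (intro ext)
  fix i h'
  show "relabel_profile (unlabel_profile \<tau>) i h' = \<tau> i h'"
  proof (cases "h' \<in> legal_histories ch2 \<epsilon> B \<and> ch2 h' \<noteq> {}")
    case True
    then obtain h where h: "h \<in> legal_histories ch1 \<epsilon> B" "h' = relabel f h"
      using legal_histories_relabel by auto
    then have ne: "ch1 h \<noteq> {}" using True choices_relabel by auto
    \<comment> \<open>\<open>f\<close> need not be surjective; \<open>f\<close> undoes
      \<open>inv f\<close> here only because the decision lies in \<open>ch2 h'\<close>, the image
      of \<open>ch1 h\<close>.\<close>
    have "\<tau> i h' \<in> UNIV \<times> ch2 h'"
      using profile_move[OF assms, of h' i] True by auto
    then show ?thesis
      using h ne by (auto simp: relabel_profile_relabel unlabel_profile_def choices_relabel inj)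
  next
    case False
    then have "\<tau> i h' = undefined" by (rule profile_undefined[OF assms])
    then show ?thesis using False by (auto simp: relabel_profile_def)
  qed
qed

lemma bij_betw_relabel_profile:
  "bij_betw relabel_profile (profiles ch1 \<epsilon> B) (profiles ch2 \<epsilon> B)"
  by (intro bij_betw_byWitness[where f' = unlabel_profile])
    (auto simp: unlabel_relabel_profile relabel_unlabel_profile relabel_profile_in
      unlabel_profile_in)

text \<open>The winner is determined by the bids, which are the same in both games, so the same
  agent's decision is carried out.\<close>

lemma play_relabel:
  assumes "\<sigma> \<in> profiles ch1 \<epsilon> B"
  shows "play ch2 (relabel_profile \<sigma>) n = relabel f (play ch1 \<sigma> n)"
proof (induction n)
  case (Suc n)
  then show ?case
    using play_legal[OF assms, of n]
    by (cases "ch1 (play ch1 \<sigma> n) = {}")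
      (simp_all add: Let_def choices_relabel relabel_profile_relabel)
qed simp

text \<open>Relabelling preserves emptiness of the choices, so both plays stop at the same least
  stage.\<close>

lemma final_history_relabel:
  assumes "\<sigma> \<in> profiles ch1 \<epsilon> B"
  shows "final_history ch2 (relabel_profile \<sigma>) = relabel f (final_history ch1 \<sigma>)"
  using play_legal[OF assms]
  by (simp add: final_history_def play_relabel[OF assms] choices_relabel)

end

section \<open>The layered game\<close>

primrec move_index :: "agent \<Rightarrow> nat" where
  "move_index Agent1 = 0"
| "move_index Agent2 = 1"

lemma inj_move_index: "inj move_index"
proof
  fix i j assume "move_index i = move_index j"
  then show "i = j" by (cases i; cases j) auto
qed

lemma UNIV_agent: "UNIV = {Agent1, Agent2}"
  using agent.exhaust by auto

text \<open>Two residues differ by less than \<open>m\<close>, so \<open>m\<close> divides their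
  difference only if it is zero. This is what makes wrapped moves with different shifts
  distinct.\<close>

lemma mod_add_left_cancel:
  fixes x y z m :: nat
  assumes "y < m" "z < m" "(x + y) mod m = (x + z) mod m"
  shows "y = z"
proof -
  have "int m dvd (int x + int y) - (int x + int z)"
    using assms(3) by (metis mod_eq_dvd_iff of_nat_add of_nat_mod)
  then have "int m dvd int y - int z" by simp
  then have "int m dvd int z - int y" by (simp add: dvd_diff_commute)
  then show ?thesis
    using zdvd_not_zless[of "int y - int z" "int m"] zdvd_not_zless[of "int z - int y" "int m"]
      \<open>int m dvd int y - int z\<close> assms(1,2)
    by linarith
qed

locale item_values =
  fixes k :: nat and v :: "agent \<Rightarrow> nat \<Rightarrow> nat"
begin

definition total :: "agent \<Rightarrow> nat" where
  "total i = (\<Sum>t<k. v i t)"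

text \<open>Radix of the pair encoding: every value collected by agent 2 is a digit below
  \<open>W\<close>.\<close>

definition W :: nat where "W = total Agent2 + 1"

definition M :: nat where "M = (total Agent1 + 1) * W"

text \<open>
  State \<open>t * M + a * W + b\<close> records that \<open>t\<close> items have been allocated, with values \<open>a\<close> and \<open>b\<close> for
  the agents.  Wrapping around modulo \<open>M\<close> affects unreachable states only; it keeps their two moves
  distinct, which truncation at the total values would not.
\<close>

definition shift :: "agent \<Rightarrow> nat \<Rightarrow> nat" where
  "shift i t = (case i of Agent1 \<Rightarrow> v Agent1 t * W | Agent2 \<Rightarrow> v Agent2 t)"

definition game :: "nat bidding_game" where
  "game =
     \<lparr>states = {..<(k + 1) * M}, initial = 0, terminals = {k * M..<(k + 1) * M},
      moves = (\<lambda>s. map (\<lambda>i. (s div M + 1) * M + (s mod M + shift i (s div M)) mod M)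
                     [Agent1, Agent2]),
      payoff = (\<lambda>i s. real (case i of Agent1 \<Rightarrow> s mod M div W | Agent2 \<Rightarrow> s mod M mod W))\<rparr>"

lemma W_pos [simp]: "W > 0" and M_pos [simp]: "M > 0"
  by (simp_all add: W_def M_def)

lemma le_total: "t < k \<Longrightarrow> v i t \<le> total i"
  unfolding total_def by (intro member_le_sum) auto

lemma code_less_M:
  assumes "a \<le> total Agent1" "b \<le> total Agent2"
  shows "a * W + b < M"
proof -
  have "a * W + b < (a + 1) * W" using assms by (simp add: W_def)
  also have "\<dots> \<le> M" unfolding M_def by (intro mult_right_mono) (use assms in auto)
  finally show ?thesis .
qed

lemma shift_less: "t < k \<Longrightarrow> shift i t < M"
  using code_less_M[of "v Agent1 t" 0] code_less_M[of 0 "v Agent2 t"] le_total[of t]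
  by (auto simp: shift_def split: agent.splits)

lemma layer_bounds:
  assumes "s < k * M"
  shows "s div M < k" "(s div M + 1) * M + x mod M < (k + 1) * M"
proof -
  show *: "s div M < k" using assms by (simp add: less_mult_imp_div_less)
  have "(s div M + 1) * M + x mod M < (s div M + 1 + 1) * M" by simp
  also have "\<dots> \<le> (k + 1) * M" by (intro mult_right_mono) (use * in auto)
  finally show "(s div M + 1) * M + x mod M < (k + 1) * M" .
qed

lemma game_simps:
  "states game = {..<(k + 1) * M}"
  "initial game = 0"
  "terminals game = {k * M..<(k + 1) * M}"
  "moves game s = map (\<lambda>i. (s div M + 1) * M + (s mod M + shift i (s div M)) mod M)
     [Agent1, Agent2]"
  "payoff game i s = real (case i of Agent1 \<Rightarrow> s mod M div W | Agent2 \<Rightarrow> s mod M mod W)"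
  by (simp_all add: game_def)

lemma states_minus_terminals: "states game - terminals game = {..<k * M}"
  by (auto simp: game_simps)

text \<open>The numbering of the states is a topological order, which reduces acyclicity to that of
  \<open><\<close>.\<close>

lemma moves_increase:
  assumes "s' \<in> set (moves game s)"
  shows "s < s'"
proof -
  have "s < (s div M + 1) * M" using dividend_less_div_times[of M s] by (simp add: algebra_simps)
  with assms show ?thesis by (auto simp: game_simps)
qed

lemma binary_game: "binary_game game"
proof -
  have "{(s, s'). s \<in> states game - terminals game \<and> s' \<in> set (moves game s)} \<subseteq> less_than"
    using moves_increase by auto
  then have "acyclic {(s, s'). s \<in> states game - terminals game \<and> s' \<in> set (moves game s)}"
    by (rule acyclic_subset[rotated]) (simp add: wf_acyclic)
  then show ?thesis
    using layer_bounds
    by (auto simp: binary_game_def states_minus_terminals) (auto simp: game_simps)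
qed

text \<open>One shift is a multiple of \<open>W\<close> and the other is below \<open>W\<close>, so
  they coincide only if both values vanish.\<close>

lemma simple_game:
  assumes "\<And>t. t < k \<Longrightarrow> \<exists>i. v i t \<noteq> 0"
  shows "simple game"
  unfolding simple_def states_minus_terminals
proof
  fix s assume "s \<in> {..<k * M}"
  then have t: "s div M < k" using layer_bounds by simp
  have "shift Agent1 (s div M) \<noteq> shift Agent2 (s div M)"
  proof
    assume eq: "shift Agent1 (s div M) = shift Agent2 (s div M)"
    have "v Agent2 (s div M) < W" using le_total[OF t, of Agent2] by (simp add: W_def)
    with eq have "v Agent1 (s div M) = 0"
      by (cases "v Agent1 (s div M)") (auto simp: shift_def)
    with eq have "v i (s div M) = 0" for i by (cases i) (auto simp: shift_def)
    with assms[OF t] show False by auto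
  qed
  then show "distinct (moves game s)"
    using mod_add_left_cancel[OF shift_less[OF t] shift_less[OF t]] by (auto simp: game_simps)
qed

lemma card_states: "card (states game) = (k + 1) * M"
  by (simp add: game_simps)

section \<open>Values collected along a history\<close>

definition won :: "agent history \<Rightarrow> agent \<Rightarrow> nat" where
  "won h i = (\<Sum>t | t < length h \<and> snd (h ! t) = i. v i t)"

lemma won_Nil [simp]: "won [] i = 0"
  by (simp add: won_def)

lemma won_snoc [simp]: "won (h @ [(b, c)]) i = won h i + (if c = i then v i (length h) else 0)"
proof -
  have "{t. t < length (h @ [(b, c)]) \<and> snd ((h @ [(b, c)]) ! t) = i} =
     {t. t < length h \<and> snd (h ! t) = i} \<union> (if c = i then {length h} else {})"
    by (auto simp: nth_append less_Suc_eq)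
  then show ?thesis by (auto simp: won_def nth_append intro!: sum.cong)
qed

lemma won_le_total:
  assumes "length h \<le> k"
  shows "won h i \<le> total i"
  unfolding won_def total_def by (intro sum_mono2) (use assms in auto)

lemma state_after_relabel:
  assumes "length h \<le> k"
  shows "state_after game (relabel move_index h) =
    length h * M + (won h Agent1 * W + won h Agent2)"
  using assms
proof (induction h rule: rev_induct)
  case Nil
  show ?case by (simp add: state_after_def game_simps)
next
  case (snoc x h)
  obtain b c where x: "x = (b, c)" by (cases x)
  define y where "y = won h Agent1 * W + won h Agent2"
  have "y < M" unfolding y_def
    by (intro code_less_M won_le_total) (use snoc.prems in auto)
  have "state_after game (relabel move_index (h @ [x])) =
      moves game (length h * M + y) ! move_index c"
    using snoc by (simp add: x state_after_def y_def)
  also have "\<dots> = (length h + 1) * M + (y + shift c (length h)) mod M"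
    using \<open>y < M\<close> by (cases c) (simp_all add: game_simps)
  also have "y + shift c (length h) =
      won (h @ [x]) Agent1 * W + won (h @ [x]) Agent2"
    by (cases c) (simp_all add: x y_def shift_def algebra_simps)
  \<comment> \<open>Values collected in at most \<open>k\<close> turns never exceed the totals, so
    no wrap-around occurs along a play.\<close>
  also have "\<dots> mod M = \<dots>"
    by (intro mod_less code_less_M won_le_total) (use snoc.prems in auto)
  finally show ?case by simp
qed

lemma payoff_final:
  assumes "length h = k"
  shows "payoff game i (state_after game (relabel move_index h)) = real (won h i)"
proof -
  have le: "won h j \<le> total j" for j using won_le_total assms by simp
  then have "won h Agent1 * W + won h Agent2 < M" by (intro code_less_M)
  moreover have "won h Agent2 < W" using le[of Agent2] by (simp add: W_def)
  ultimately show ?thesis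
    by (cases i) (simp_all add: state_after_relabel assms game_simps)
qed

lemma game_choices_relabel:
  assumes "length h \<le> k"
  shows "game_choices game (relabel move_index h) =
    (if length h < k then move_index ` UNIV else {})"
proof -
  define y where "y = won h Agent1 * W + won h Agent2"
  have y: "y < M" unfolding y_def by (intro code_less_M won_le_total assms)
  have "length h * M + y < k * M" if "length h < k"
  proof -
    have "length h * M + y < (length h + 1) * M" using y by simp
    also have "\<dots> \<le> k * M" by (intro mult_right_mono) (use that in auto)
    finally show ?thesis .
  qed
  then have "state_after game (relabel move_index h) \<in> terminals game \<longleftrightarrow> \<not> length h < k"
    using assms y
    by (cases "length h < k") (auto simp: state_after_relabel y_def[symmetric] game_simps)
  then show ?thesis
    by (auto simp: game_choices_def game_simps UNIV_agent less_Suc_eq)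
qed

end

section \<open>Equivalence\<close>

text \<open>The bound matters: a move beyond layer \<open>k\<close> leaves the terminal states, so
  on overlong histories the game would offer moves again while the bargaining offers none.\<close>

lemma legal_ssb_length:
  assumes "h \<in> legal_histories (ssb_choices F) \<epsilon> B"
  shows "length h \<le> card (items F)"
  using assms by induction (auto simp: ssb_choices_def split: if_splits)

text \<open>Play grows by one turn per stage and then stalls, whatever the strategies do.\<close>

lemma length_final_history_ssb: "length (final_history (ssb_choices F) \<sigma>) = card (items F)"
proof -
  have len: "length (play (ssb_choices F) \<sigma> n) = min n (card (items F))" for n
    by (induction n) (auto simp: Let_def ssb_choices_def)
  have "(LEAST n. ssb_choices F (play (ssb_choices F) \<sigma> n) = {}) = card (items F)"
    by (rule Least_equality) (auto simp: ssb_choices_def len split: if_splits)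
  then show ?thesis by (simp add: final_history_def len)
qed

locale integral_ssb =
  fixes F :: "'a ssb"
  assumes ssb: "ssb F" and additive: "additive_valued F"
    and integer: "integer_valued F" and nonneg: "nonnegative_valued F"
begin

text \<open>Items are replaced by their positions in the order of sale. The rounding is the one of
  \<open>ssb_code\<close>, so the program's input agrees literally, and it is exact for nonnegative
  integers.\<close>

sublocale item_values "card (items F)" "\<lambda>i t. nat \<lfloor>val F i {sale_order F ! t}\<rfloor>" .

lemma length_sale_order: "length (sale_order F) = card (items F)"
  using ssb distinct_card[of "sale_order F"] by (simp add: ssb_def)

lemma sale_order_in: "t < card (items F) \<Longrightarrow> sale_order F ! t \<in> items F"
  using ssb nth_mem[of t "sale_order F"] by (simp add: ssb_def length_sale_order)

lemma real_item_value:
  assumes "t < card (items F)"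
  shows "real (nat \<lfloor>val F i {sale_order F ! t}\<rfloor>) = val F i {sale_order F ! t}"
proof -
  have "{sale_order F ! t} \<subseteq> items F" using sale_order_in[OF assms] by simp
  then have "val F i {sale_order F ! t} \<in> \<int>" "0 \<le> val F i {sale_order F ! t}"
    using integer nonneg unfolding integer_valued_def nonnegative_valued_def by blast+
  then obtain n where "val F i {sale_order F ! t} = of_int n" "0 \<le> n"
    by (metis Ints_cases of_int_0_le_iff)
  then show ?thesis by simp
qed

lemma val_image:
  assumes "T \<subseteq> {..<card (items F)}"
  shows "val F i ((!) (sale_order F) ` T) =
    real (\<Sum>t\<in>T. nat \<lfloor>val F i {sale_order F ! t}\<rfloor>)"
proof -
  have sub: "(!) (sale_order F) ` T \<subseteq> items F"
    using sale_order_in assms by (intro image_subsetI) blast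
  have inj: "inj_on ((!) (sale_order F)) T"
    using ssb assms by (intro inj_on_nth) (auto simp: ssb_def length_sale_order)
  have "val F i ((!) (sale_order F) ` T) = (\<Sum>j\<in>(!) (sale_order F) ` T. val F i {j})"
    using additive sub unfolding additive_valued_def by blast
  also have "\<dots> = (\<Sum>t\<in>T. val F i {sale_order F ! t})"
    by (simp add: sum.reindex[OF inj])
  also have "\<dots> = (\<Sum>t\<in>T. real (nat \<lfloor>val F i {sale_order F ! t}\<rfloor>))"
    using assms by (intro sum.cong refl real_item_value[symmetric]) blast
  finally show ?thesis by (simp only: of_nat_sum)
qed

lemma real_total: "real (total i) = val F i (items F)"
proof -
  have "(!) (sale_order F) ` {..<card (items F)} = items F"
    using ssb length_sale_order by (auto simp: ssb_def set_conv_nth)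
  then show ?thesis using val_image[of "{..<card (items F)}" i] by (simp add: total_def)
qed

lemma real_won:
  assumes "length h \<le> card (items F)"
  shows "real (won h i) = val F i (allocation F h i)"
proof -
  have "allocation F h i = (!) (sale_order F) ` {t. t < length h \<and> snd (h ! t) = i}"
    by (auto simp: allocation_def)
  moreover have "{t. t < length h \<and> snd (h ! t) = i} \<subseteq> {..<card (items F)}"
    using assms by auto
  ultimately show ?thesis using val_image by (simp add: won_def)
qed

lemma equivalent_game: "equivalent F game"
  unfolding equivalent_def
proof (intro allI impI ballI)
  fix \<epsilon> :: real and B
  have choices: "game_choices game (relabel move_index h) = move_index ` ssb_choices F h"
    if "h \<in> legal_histories (ssb_choices F) \<epsilon> B" for h
    using game_choices_relabel[OF legal_ssb_length[OF that]] by (simp add: ssb_choices_def)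
  let ?\<phi> = "relabel_profile move_index (game_choices game) \<epsilon> B"
  have "game_utility game (?\<phi> \<sigma>) i = ssb_utility F \<sigma> i"
    if "\<sigma> \<in> profiles (ssb_choices F) \<epsilon> B" for \<sigma> i
    using final_history_relabel[where f = move_index and ?ch1.0 = "ssb_choices F"
        and ?ch2.0 = "game_choices game", OF inj_move_index choices that]
    by (simp add: game_utility_def ssb_utility_def payoff_final real_won length_final_history_ssb)
  then show "\<exists>\<phi>. bij_betw \<phi> (profiles (ssb_choices F) \<epsilon> B) (profiles (game_choices game) \<epsilon> B) \<and>
      (\<forall>\<sigma>\<in>profiles (ssb_choices F) \<epsilon> B. \<forall>i. game_utility game (\<phi> \<sigma>) i = ssb_utility F \<sigma> i)"
    using bij_betw_relabel_profile[where f = move_index and ?ch1.0 = "ssb_choices F"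
        and ?ch2.0 = "game_choices game", OF inj_move_index choices] by blast
qed

end

section \<open>Running times of programs\<close>

type_synonym assertion = "(nat \<Rightarrow> nat) \<Rightarrow> nat list \<Rightarrow> bool"

text \<open>A Hoare triple for total correctness with a step bound; an upper bound instead of an
  exact count absorbs branches of different lengths.\<close>

definition triple :: "nat list \<Rightarrow> assertion \<Rightarrow> prog \<Rightarrow> nat \<Rightarrow> assertion \<Rightarrow> bool" where
  "triple inp P p t Q \<longleftrightarrow>
     (\<forall>r out. P r out \<longrightarrow>
        (\<exists>n r' out'. n \<le> t \<and> exec inp p (r, out) n (r', out') \<and> Q r' out'))"

lemma triple_Seq:
  assumes "triple inp P p m Q" "triple inp Q q n R"
  shows "triple inp P (Seq p q) (m + n) R"
  using assms unfolding triple_def by (meson add_mono exec.Seq)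

lemma triple_weaken:
  assumes "triple inp P p m Q" "\<And>r out. P' r out \<Longrightarrow> P r out" "m \<le> m'"
    "\<And>r out. Q r out \<Longrightarrow> Q' r out"
  shows "triple inp P' p m' Q'"
  using assms unfolding triple_def by (meson order_trans)

text \<open>The invariant is indexed by the completed iterations and register \<open>x\<close>
  counts down. Each iteration pays one step for its test, and the failing test at the end pays the
  last one.\<close>

lemma triple_While:
  assumes body: "\<And>i. i < m \<Longrightarrow> triple inp (I i) p t (I (Suc i))"
    and test: "\<And>i r out. I i r out \<Longrightarrow> r x = m - i"
  shows "triple inp (I 0) (WhileNZ x p) (m * Suc t + 1) (I m)"
proof -
  have "\<exists>n r' out'. n \<le> (m - i) * Suc t + 1 \<and>
      exec inp (WhileNZ x p) (r, out) n (r', out') \<and> I m r' out'"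
    if "i \<le> m" "I i r out" for i r out
    using that
  proof (induction i arbitrary: r out rule: inc_induct)
    case base
    then have "exec inp (WhileNZ x p) (r, out) 1 (r, out)"
      using test[of m r out] by (intro exec.WhileFalse) simp
    with base show ?case by fastforce
  next
    case (step i)
    obtain n r' out' where 1: "n \<le> t" "exec inp p (r, out) n (r', out')" "I (Suc i) r' out'"
      using body[OF step.hyps(2)] step.prems unfolding triple_def by blast
    obtain n' r'' out'' where 2: "n' \<le> (m - Suc i) * Suc t + 1"
      "exec inp (WhileNZ x p) (r', out') n' (r'', out'')" "I m r'' out''"
      using step.IH[OF 1(3)] by blast
    have "r x \<noteq> 0" using test[OF step.prems] step.hyps by simp
    then have "exec inp (WhileNZ x p) (r, out) (Suc (n + n')) (r'', out'')"
      using 1 2 by (intro exec.WhileTrue)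
    moreover have "m - i = Suc (m - Suc i)" using step.hyps by simp
    then have "Suc (n + n') \<le> (m - i) * Suc t + 1" using 1 2 by simp
    ultimately show ?case using 2 by blast
  qed
  from this[of 0] show ?thesis by (simp add: triple_def)
qed

text \<open>Turns straight-line code into equations that the simplifier can run. The clause for
  loops is a dummy that \<open>loop_free\<close> excludes.\<close>

fun eff :: "nat list \<Rightarrow> prog \<Rightarrow> (nat \<Rightarrow> nat) \<times> nat list \<Rightarrow> (nat \<Rightarrow> nat) \<times> nat list" where
  "eff inp (Const x n) (r, out) = (r(x := n), out)"
| "eff inp (Add x y z) (r, out) = (r(x := r y + r z), out)"
| "eff inp (Sub x y z) (r, out) = (r(x := r y - r z), out)"
| "eff inp (Input x y) (r, out) = (r(x := if r y < length inp then inp ! r y else 0), out)"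
| "eff inp (Output x) (r, out) = (r, out @ [r x])"
| "eff inp (Seq p q) s = eff inp q (eff inp p s)"
| "eff inp (IfNZ x p q) (r, out) = (if r x \<noteq> 0 then eff inp p (r, out) else eff inp q (r, out))"
| "eff inp (WhileNZ x p) s = s"

fun loop_free :: "prog \<Rightarrow> bool" where
  "loop_free (Seq p q) \<longleftrightarrow> loop_free p \<and> loop_free q"
| "loop_free (IfNZ x p q) \<longleftrightarrow> loop_free p \<and> loop_free q"
| "loop_free (WhileNZ x p) \<longleftrightarrow> False"
| "loop_free _ \<longleftrightarrow> True"

fun cost :: "prog \<Rightarrow> nat" where
  "cost (Seq p q) = cost p + cost q"
| "cost (IfNZ x p q) = Suc (max (cost p) (cost q))"
| "cost _ = 1"

lemma exec_loop_free:
  assumes "loop_free p"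
  shows "\<exists>n\<le>cost p. exec inp p s n (eff inp p s)"
  using assms
proof (induction p arbitrary: s)
  case (Seq p q)
  then obtain m n where "m \<le> cost p" "exec inp p s m (eff inp p s)"
    "n \<le> cost q" "exec inp q (eff inp p s) n (eff inp q (eff inp p s))"
    by (metis loop_free.simps(1))
  then show ?case by (auto intro!: exI[of _ "m + n"] exec.Seq)
next
  case (IfNZ x p q)
  obtain r out where s: "s = (r, out)" by (cases s)
  show ?case
  proof (cases "r x = 0")
    case True
    obtain n where "n \<le> cost q" "exec inp q s n (eff inp q s)" using IfNZ by fastforce
    then show ?thesis using True s by (auto intro!: exI[of _ "Suc n"] exec.IfFalse)
  next
    case False
    obtain n where "n \<le> cost p" "exec inp p s n (eff inp p s)" using IfNZ by fastforce
    then show ?thesis using False s by (auto intro!: exI[of _ "Suc n"] exec.IfTrue)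
  qed
qed (auto split: prod.splits intro: exec.intros simp del: One_nat_def
    intro!: exI[of _ 1] simp: exec.Const exec.Add exec.Sub exec.Input exec.Output)

lemma triple_loop_free:
  assumes "loop_free p" "\<And>r out. P r out \<Longrightarrow> case eff inp p (r, out) of (r', out') \<Rightarrow> Q r' out'"
    "cost p \<le> t"
  shows "triple inp P p t Q"
  unfolding triple_def
proof (intro allI impI)
  fix r out assume "P r out"
  then show "\<exists>n r' out'. n \<le> t \<and> exec inp p (r, out) n (r', out') \<and> Q r' out'"
    using assms(2)[of r out] exec_loop_free[OF assms(1), of inp "(r, out)"] assms(3)
    by (cases "eff inp p (r, out)") (auto intro: order_trans)
qed

lemma triple_loop:
  assumes "\<And>i r out. i < m \<Longrightarrow> I i r out \<Longrightarrow>
      case eff inp p (r, out) of (r', out') \<Rightarrow> I (Suc i) r' out'"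
    and "\<And>i r out. I i r out \<Longrightarrow> r x = m - i" "loop_free p" "m * Suc (cost p) + 1 \<le> t"
  shows "triple inp (I 0) (WhileNZ x p) t (I m)"
proof (rule triple_weaken)
  show "triple inp (I 0) (WhileNZ x p) (m * Suc (cost p) + 1) (I m)"
    by (rule triple_While[OF triple_loop_free]) (use assms in auto)
qed (use assms in auto)

text \<open>There is no skip instruction; a write to scratch register 13 stands in for it.\<close>

fun block :: "prog list \<Rightarrow> prog" where
  "block [] = Const 13 0"
| "block [p] = p"
| "block (p # q # ps) = Seq p (block (q # ps))"

section \<open>The program\<close>

text \<open>
  Registers: 0 number of items, 1 total value for agent 1 plus one, 2 \<open>W\<close>, 3 \<open>M\<close>, 4 number of states,
  5 input position, 6 one, 7 and 14 outer and inner loop counters, 8 first state of the next layer,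
  9 and 10 offsets or payoffs, 11 value of the current item for agent 2, 12 and 13 scratch, 15 two, 16 zero.
  In the main loop, 9 is the offset within the layer and 10 the offset added by agent 1's move.
  Within the terminal layer, 9 and 10 are the two payoffs.
\<close>

definition sum_values :: prog where
  "sum_values = WhileNZ 7 (block [Input 12 5, Add 1 1 12, Add 5 5 6, Input 12 5, Add 2 2 12,
     Add 5 5 6, Sub 7 7 6])"

text \<open>Multiplication by repeated addition, as in the next two loops.\<close>

definition count_layer :: prog where
  "count_layer = WhileNZ 7 (block [Add 3 3 2, Sub 7 7 6])"

definition count_states :: prog where
  "count_states = WhileNZ 7 (block [Add 4 4 3, Sub 7 7 6])"

definition scale_value :: prog where
  "scale_value = WhileNZ 14 (block [Add 10 10 2, Sub 14 14 6])"

text \<open>Addition modulo \<open>M\<close>: both summands are below \<open>M\<close>, so one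
  conditional subtraction suffices. The truncated difference in register 13 is nonzero exactly if
  the sum is below \<open>M\<close>.\<close>

definition put_move :: "nat \<Rightarrow> prog" where
  "put_move x = block [Add 12 9 x, Sub 13 3 12, IfNZ 13 (Const 13 0) (Sub 12 12 3), Add 12 12 8,
     Output 12]"

definition put_layer :: prog where
  "put_layer = WhileNZ 14 (block [Output 15, put_move 10, put_move 11, Add 9 9 6, Sub 14 14 6])"

definition put_layers :: prog where
  "put_layers = WhileNZ 7 (block [
     block [Input 14 5, Add 5 5 6, Input 11 5, Add 5 5 6, Add 8 8 3, Const 10 0],
     scale_value,
     block [Add 14 3 16, Const 9 0],
     put_layer,
     Sub 7 7 6])"

definition put_row :: prog where
  "put_row = WhileNZ 14 (block [Output 16, Output 9, Output 10, Add 10 10 6, Sub 14 14 6])"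

text \<open>Running through agent 1's payoff outside and agent 2's inside lists the codes
  \<open>a * W + b\<close> in increasing order, so the payoffs are just the loop counters.\<close>

definition put_terminals :: prog where
  "put_terminals = WhileNZ 7 (block [
     block [Add 14 2 16, Const 10 0],
     put_row,
     block [Add 9 9 6, Sub 7 7 6]])"

text \<open>Register 16 is never written and keeps its initial zero: adding it copies a register,
  and it also serves as an input position and as the initial state.\<close>

definition builder :: prog where
  "builder = block [
     block [Const 6 1, Const 15 2, Const 1 1, Const 2 1, Input 0 16, Const 5 1, Add 7 0 16],
     sum_values,
     Add 7 1 16,
     count_layer,
     Add 7 0 6,
     count_states,
     block [Output 4, Output 16, Add 7 0 16, Const 5 1],
     put_layers,
     block [Add 7 1 16, Const 9 0],
     put_terminals]"

lemma length_pairs: "length (concat (map (\<lambda>t. [f t, g t]) [0..<n])) = 2 * n"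
  by (induction n) auto

lemma pairs_nth:
  fixes f g :: "nat \<Rightarrow> nat"
  assumes "t < n"
  shows "concat (map (\<lambda>t. [f t, g t]) [0..<n]) ! (2 * t) = f t"
    and "concat (map (\<lambda>t. [f t, g t]) [0..<n]) ! Suc (2 * t) = g t"
  using assms by (induction n) (auto simp: nth_append length_pairs less_Suc_eq simp del: length_concat)

context item_values
begin

section \<open>Encodings of the input and of the states\<close>

definition input :: "nat list" where
  "input = k # concat (map (\<lambda>t. [v Agent1 t, v Agent2 t]) [0..<k])"

lemma length_input: "length input = Suc (2 * k)"
  by (simp add: input_def length_pairs del: length_concat)

lemma input_nth:
  assumes "t < k"
  shows "input ! Suc (2 * t) = v Agent1 t" "input ! Suc (Suc (2 * t)) = v Agent2 t"
  using pairs_nth[OF assms] by (simp_all add: input_def)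

text \<open>The output, header included, once \<open>s\<close> states are written; letting
  \<open>s\<close> vary makes it an invariant of the output loops.\<close>

definition codes :: "nat \<Rightarrow> nat list" where
  "codes s = (k + 1) * M # 0 # concat (map (state_code game) [0..<s])"

lemma codes_Suc: "codes (Suc s) = codes s @ state_code game s"
  by (simp add: codes_def)

lemma is_code: "is_code_of (codes ((k + 1) * M)) game"
  by (auto simp: is_code_of_def codes_def game_simps)

lemma state_code_nonterminal:
  assumes "t < k" "x < M"
  shows "state_code game (t * M + x) =
    [2, Suc t * M + (x + v Agent1 t * W) mod M, Suc t * M + (x + v Agent2 t) mod M]"
proof -
  have "t * M + x < (t + 1) * M" using assms by simp
  also have "\<dots> \<le> k * M" by (intro mult_right_mono) (use assms in auto)
  finally show ?thesis using assms by (simp add: state_code_def game_simps shift_def)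
qed

lemma state_code_terminal:
  assumes "a \<le> total Agent1" "b < W"
  shows "state_code game (k * M + (a * W + b)) = [0, a, b]"
proof -
  have "a * W + b < M" using assms by (intro code_less_M) (auto simp: W_def)
  then show ?thesis using assms by (simp add: state_code_def game_simps)
qed

lemma wrap_mod: "x < M \<Longrightarrow> y < M \<Longrightarrow> (if M - (x + y) \<noteq> 0 then x + y else x + y - M) = (x + y) mod M"
  by (simp add: mod_if)

section \<open>Loop invariants and step bounds\<close>

definition regs :: "(nat \<Rightarrow> nat) \<Rightarrow> bool" where
  "regs r \<longleftrightarrow> r 0 = k \<and> r 6 = 1 \<and> r 15 = 2 \<and> r 16 = 0"

definition ready :: "(nat \<Rightarrow> nat) \<Rightarrow> bool" where
  "ready r \<longleftrightarrow> regs r \<and> r 1 = total Agent1 + 1 \<and> r 2 = W \<and> r 3 = M"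

text \<open>Registers 3, 4 and 8 are recorded as zero because later loops accumulate in them without
  initializing them.\<close>

definition sum_inv :: "nat \<Rightarrow> assertion" where
  "sum_inv i r out \<longleftrightarrow> regs r \<and> r 1 = (\<Sum>t<i. v Agent1 t) + 1 \<and> r 2 = (\<Sum>t<i. v Agent2 t) + 1 \<and>
     r 3 = 0 \<and> r 4 = 0 \<and> r 8 = 0 \<and> r 5 = Suc (2 * i) \<and> r 7 = k - i \<and> out = []"

lemma sum_values: "triple input (sum_inv 0) sum_values (k * 8 + 1) (sum_inv k)"
  unfolding sum_values_def
  by (rule triple_loop) (auto simp: sum_inv_def regs_def length_input input_nth)

definition layer_inv :: "nat \<Rightarrow> assertion" where
  "layer_inv i r out \<longleftrightarrow> regs r \<and> r 1 = total Agent1 + 1 \<and> r 2 = W \<and> r 3 = i * W \<and> r 4 = 0 \<and>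
     r 8 = 0 \<and> r 7 = total Agent1 + 1 - i \<and> out = []"

lemma count_layer:
  "triple input (layer_inv 0) count_layer ((total Agent1 + 1) * 3 + 1) (layer_inv (total Agent1 + 1))"
  unfolding count_layer_def
  by (rule triple_loop) (auto simp: layer_inv_def regs_def)

definition states_inv :: "nat \<Rightarrow> assertion" where
  "states_inv i r out \<longleftrightarrow> ready r \<and> r 4 = i * M \<and> r 8 = 0 \<and> r 7 = k + 1 - i \<and> out = []"

lemma count_states: "triple input (states_inv 0) count_states ((k + 1) * 3 + 1) (states_inv (k + 1))"
  unfolding count_states_def
  by (rule triple_loop) (auto simp: states_inv_def ready_def regs_def)

definition layers_inv :: "nat \<Rightarrow> assertion" where
  "layers_inv t r out \<longleftrightarrow> ready r \<and> r 5 = Suc (2 * t) \<and> r 8 = t * M \<and> r 7 = k - t \<and>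
     out = codes (t * M)"

text \<open>Inside iteration \<open>t\<close> of the main loop registers 5 and 8 have already
  advanced to \<open>Suc t\<close>, while the counter 7 is decremented only at the end.\<close>

definition scale_inv :: "nat \<Rightarrow> nat \<Rightarrow> assertion" where
  "scale_inv t i r out \<longleftrightarrow> ready r \<and> r 5 = Suc (2 * Suc t) \<and> r 8 = Suc t * M \<and> r 7 = k - t \<and>
     r 11 = v Agent2 t \<and> r 10 = i * W \<and> r 14 = v Agent1 t - i \<and> out = codes (t * M)"

definition offset_inv :: "nat \<Rightarrow> nat \<Rightarrow> assertion" where
  "offset_inv t x r out \<longleftrightarrow> ready r \<and> r 5 = Suc (2 * Suc t) \<and> r 8 = Suc t * M \<and> r 7 = k - t \<and>
     r 11 = v Agent2 t \<and> r 10 = v Agent1 t * W \<and> r 9 = x \<and> r 14 = M - x \<and> out = codes (t * M + x)"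

lemma scale_value:
  "triple input (scale_inv t 0) scale_value (v Agent1 t * 3 + 1) (scale_inv t (v Agent1 t))"
  unfolding scale_value_def
  by (rule triple_loop) (auto simp: scale_inv_def ready_def regs_def)

text \<open>The 16 steps per state are six for each of the two moves, three further instructions and
  the loop test.\<close>

lemma put_layer:
  assumes "t < k"
  shows "triple input (offset_inv t 0) put_layer (M * 16 + 1) (offset_inv t M)"
  unfolding put_layer_def
proof (rule triple_loop)
  fix x r out assume x: "x < M" and inv: "offset_inv t x r out"
  have s: "v Agent1 t * W < M" "v Agent2 t < M"
    using shift_less[OF assms, of Agent1] shift_less[OF assms, of Agent2] by (simp_all add: shift_def)
  show "case eff input (block [Output 15, put_move 10, put_move 11, Add 9 9 6, Sub 14 14 6])
      (r, out) of (r', out') \<Rightarrow> offset_inv t (Suc x) r' out'"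
    using inv wrap_mod[OF x s(1)] wrap_mod[OF x s(2)] assms x
    by (auto simp: offset_inv_def ready_def regs_def put_move_def codes_Suc state_code_nonterminal
        split: if_splits)
qed (auto simp: offset_inv_def put_move_def)

text \<open>\<open>triple_While\<close> wants one bound for all iterations, so the cost of scaling
  each item is estimated by \<open>total Agent1\<close>.\<close>

lemma put_layers:
  "triple input (layers_inv 0) put_layers (k * (total Agent1 * 3 + M * 16 + 12) + 1) (layers_inv k)"
proof -
  have "triple input (layers_inv t) (block [
     block [Input 14 5, Add 5 5 6, Input 11 5, Add 5 5 6, Add 8 8 3, Const 10 0],
     scale_value,
     block [Add 14 3 16, Const 9 0],
     put_layer,
     Sub 7 7 6]) (total Agent1 * 3 + M * 16 + 11) (layers_inv (Suc t))" if t: "t < k" for t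
  proof -
    have "triple input (layers_inv t)
        (block [Input 14 5, Add 5 5 6, Input 11 5, Add 5 5 6, Add 8 8 3, Const 10 0]) 6
        (scale_inv t 0)"
      by (rule triple_loop_free)
        (use t in \<open>auto simp: layers_inv_def scale_inv_def ready_def regs_def length_input input_nth\<close>)
    moreover have "triple input (scale_inv t (v Agent1 t)) (block [Add 14 3 16, Const 9 0]) 2
        (offset_inv t 0)"
      by (rule triple_loop_free) (auto simp: offset_inv_def scale_inv_def ready_def regs_def)
    moreover have "triple input (offset_inv t M) (Sub 7 7 6) 1 (layers_inv (Suc t))"
      by (rule triple_loop_free)
        (auto simp: offset_inv_def layers_inv_def ready_def regs_def add.commute)
    ultimately show ?thesis
      unfolding block.simps(2,3)
      by (rule triple_weaken[OF triple_Seq[OF _ triple_Seq[OF scale_value triple_Seq[OF _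
                triple_Seq[OF put_layer[OF t]]]]]])
        (use le_total[OF t, of Agent1] in auto)
  qed
  from triple_While[where I = layers_inv and m = k, OF this, of 7] show ?thesis
    by (simp add: put_layers_def layers_inv_def ac_simps)
qed

definition rows_inv :: "nat \<Rightarrow> assertion" where
  "rows_inv a r out \<longleftrightarrow> ready r \<and> r 9 = a \<and> r 7 = total Agent1 + 1 - a \<and>
     out = codes (k * M + a * W)"

definition row_inv :: "nat \<Rightarrow> nat \<Rightarrow> assertion" where
  "row_inv a b r out \<longleftrightarrow> ready r \<and> r 9 = a \<and> r 7 = total Agent1 + 1 - a \<and> r 10 = b \<and>
     r 14 = W - b \<and> out = codes (k * M + (a * W + b))"

lemma put_row:
  assumes "a \<le> total Agent1"
  shows "triple input (row_inv a 0) put_row (W * 6 + 1) (row_inv a W)"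
  unfolding put_row_def
  by (rule triple_loop)
    (use assms in \<open>auto simp: row_inv_def ready_def regs_def codes_Suc state_code_terminal\<close>)

lemma put_terminals:
  "triple input (rows_inv 0) put_terminals ((total Agent1 + 1) * (W * 6 + 6) + 1)
     (rows_inv (total Agent1 + 1))"
proof -
  have "triple input (rows_inv a)
     (block [block [Add 14 2 16, Const 10 0], put_row, block [Add 9 9 6, Sub 7 7 6]])
     (W * 6 + 5) (rows_inv (Suc a))" if "a < total Agent1 + 1" for a
  proof -
    have a: "a \<le> total Agent1" using that by simp
    have "triple input (rows_inv a) (block [Add 14 2 16, Const 10 0]) 2 (row_inv a 0)"
      by (rule triple_loop_free) (auto simp: rows_inv_def row_inv_def ready_def regs_def)
    moreover have "triple input (row_inv a W) (block [Add 9 9 6, Sub 7 7 6]) 2 (rows_inv (Suc a))"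
      by (rule triple_loop_free)
        (auto simp: rows_inv_def row_inv_def ready_def regs_def add.commute)
    ultimately show ?thesis
      unfolding block.simps(2,3)
      by (rule triple_weaken[OF triple_Seq[OF _ triple_Seq[OF put_row[OF a]]]]) auto
  qed
  from triple_While[where I = rows_inv and m = "total Agent1 + 1", OF this, of 7] show ?thesis
    by (simp add: put_terminals_def rows_inv_def ac_simps)
qed

section \<open>Total running time\<close>

lemma builder:
  "triple input (\<lambda>r out. r = (\<lambda>_. 0) \<and> out = []) builder (100 * ((k + 1) * M))
     (\<lambda>r out. out = codes ((k + 1) * M))"
proof -
  have M_eq: "M = total Agent1 * W + W" by (simp add: M_def)
  have 1: "triple input (\<lambda>r out. r = (\<lambda>_. 0) \<and> out = [])
      (block [Const 6 1, Const 15 2, Const 1 1, Const 2 1, Input 0 16, Const 5 1, Add 7 0 16]) 7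
      (sum_inv 0)"
    by (rule triple_loop_free) (auto simp: sum_inv_def regs_def input_def)
  have 2: "triple input (sum_inv k) (Add 7 1 16) 1 (layer_inv 0)"
    by (rule triple_loop_free) (auto simp: sum_inv_def layer_inv_def regs_def total_def W_def)
  have 3: "triple input (layer_inv (total Agent1 + 1)) (Add 7 0 6) 1 (states_inv 0)"
    by (rule triple_loop_free)
      (auto simp: layer_inv_def states_inv_def ready_def regs_def M_def)
  have 4: "triple input (states_inv (k + 1)) (block [Output 4, Output 16, Add 7 0 16, Const 5 1]) 4
      (layers_inv 0)"
    by (rule triple_loop_free)
      (auto simp: states_inv_def layers_inv_def ready_def regs_def codes_def)
  have 5: "triple input (layers_inv k) (block [Add 7 1 16, Const 9 0]) 2 (rows_inv 0)"
    by (rule triple_loop_free) (auto simp: layers_inv_def rows_inv_def ready_def regs_def)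
  \<comment> \<open>These estimates bound every summand by a multiple of \<open>k * M\<close> or of
    \<open>M\<close>; each kind has total coefficient below 50, so 100 is generous.\<close>
  have "total Agent1 + 1 \<le> M" by (simp add: M_def W_def)
  moreover have "k * total Agent1 \<le> k * M" using calculation by (intro mult_left_mono) auto
  moreover have "k \<le> k * M" using M_pos by (cases M) auto
  ultimately have "7 + (k * 8 + 1 + (1 + ((total Agent1 + 1) * 3 + 1 + (1 + ((k + 1) * 3 + 1 +
      (4 + (k * (total Agent1 * 3 + M * 16 + 12) + 1 + (2 +
      ((total Agent1 + 1) * (W * 6 + 6) + 1))))))))) \<le> 100 * ((k + 1) * M)"
    using M_eq by (simp add: algebra_simps)
  \<comment> \<open>The position after the last terminal row is the number of all states, so the
    output is complete.\<close>
  moreover have "k * M + (total Agent1 + 1) * W = (k + 1) * M" by (simp add: M_def)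
  ultimately show ?thesis
    unfolding builder_def block.simps(2,3)
    by (intro triple_weaken[OF triple_Seq[OF 1[unfolded block.simps(2,3)]
          triple_Seq[OF sum_values triple_Seq[OF 2
            triple_Seq[OF count_layer triple_Seq[OF 3 triple_Seq[OF count_states
              triple_Seq[OF 4[unfolded block.simps(2,3)] triple_Seq[OF put_layers
                triple_Seq[OF 5[unfolded block.simps(2,3)] put_terminals]]]]]]]]]])
      (auto simp only: rows_inv_def)
qed

lemma computes_within_builder:
  "computes_within builder input (codes ((k + 1) * M)) (real (100 * ((k + 1) * M)))"
proof -
  obtain n r where n: "n \<le> 100 * ((k + 1) * M)"
    "exec input builder (\<lambda>_. 0, []) n (r, codes ((k + 1) * M))"
    using builder unfolding triple_def by blast
  then have "real n \<le> real (100 * ((k + 1) * M))" by (simp only: of_nat_le_iff)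
  with n show ?thesis unfolding computes_within_def by blast
qed

end

lemma (in integral_ssb) ssb_code: "ssb_code F = input"
proof -
  have "map g (sale_order F) = map (\<lambda>t. g (sale_order F ! t)) [0..<card (items F)]"
    for g :: "'a \<Rightarrow> nat list"
    by (rule nth_equalityI) (simp_all add: length_sale_order)
  then show ?thesis by (simp add: ssb_code_def input_def)
qed

theorem proposition19:
  shows "\<exists>P c d. \<forall>F :: 'a ssb.
    ssb F \<and> additive_valued F \<and> integer_valued F \<and> nonnegative_valued F \<longrightarrow>
    (let k = card (items F);
         M = (val F Agent1 (items F) + 1) * (val F Agent2 (items F) + 1)
     in \<exists>G :: nat bidding_game.
          binary_game G \<and>
          ((\<forall>j\<in>items F. \<exists>i. val F i {j} \<noteq> 0) \<longrightarrow> simple G) \<and>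
          real (card (states G)) \<le> real (k + 1) * M \<and>
          equivalent F G \<and>
          (\<exists>xs. is_code_of xs G \<and>
             computes_within P (ssb_code F) xs (real c * (real (k + 1) * M) ^ d)))"
\<comment> \<open>The witnesses are uniform in \<open>F\<close>; the exponent is 1 because the time
  is linear in the number of states.\<close>
proof (rule exI[of _ builder], rule exI[of _ 100], rule exI[of _ 1], intro allI impI)
  fix F :: "'a ssb"
  assume "ssb F \<and> additive_valued F \<and> integer_valued F \<and> nonnegative_valued F"
  then interpret integral_ssb F by unfold_locales auto
  have M: "(val F Agent1 (items F) + 1) * (val F Agent2 (items F) + 1) = real M"
    by (simp add: M_def W_def algebra_simps flip: real_total)
  have "simple game" if worth: "\<forall>j\<in>items F. \<exists>i. val F i {j} \<noteq> 0"
  proof (rule simple_game)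
    fix t assume t: "t < card (items F)"
    then obtain i where "val F i {sale_order F ! t} \<noteq> 0" using worth sale_order_in by blast
    then show "\<exists>i. nat \<lfloor>val F i {sale_order F ! t}\<rfloor> \<noteq> 0"
      using real_item_value[OF t, of i] by (metis of_nat_0)
  qed
  moreover have "computes_within builder (ssb_code F) (codes ((card (items F) + 1) * M))
      (real 100 * (real (card (items F) + 1) * real M) ^ 1)"
    using computes_within_builder by (simp add: ssb_code algebra_simps)
  moreover have "real (card (states game)) \<le> real (card (items F) + 1) * real M"
    by (simp only: card_states of_nat_mult order_refl)
  ultimately show "let k = card (items F);
         M = (val F Agent1 (items F) + 1) * (val F Agent2 (items F) + 1)
     in \<exists>G :: nat bidding_game.
          binary_game G \<and>
          ((\<forall>j\<in>items F. \<exists>i. val F i {j} \<noteq> 0) \<longrightarrow> simple G) \<and>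
          real (card (states G)) \<le> real (k + 1) * M \<and>
          equivalent F G \<and>
          (\<exists>xs. is_code_of xs G \<and>
             computes_within builder (ssb_code F) xs (real 100 * (real (k + 1) * M) ^ 1))"
    unfolding Let_def M
    using binary_game equivalent_game is_code
    by (intro exI[of _ game]) (auto simp del: power_one_right)
qed

end
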